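(* There exist integers $d\ge 2$ and $n=k\ge 2$, an $n$-partite state $\varrho$ on $(\mathbb{C}^d)^{\otimes n}$ and an entanglement witness $W$ on $(\mathbb{C}^d)^{\otimes k}$ such that $$\operatorname{tr}(W\varrho)\ge 0,$$ but for which there is a positive semidefinite operator $P\ge 0$, acting on the $k$ copies of the parties $2,\dots,n$, such that $$\operatorname{tr}\big((W\otimes P)\,\varrho^{\otimes k}\big)<0,$$ where $W$ acts on the $k$ copies of party $1$. That is, linear entanglement detection of $\varrho$ with $W$ fails, but nonlinear detection with $W\otimes P$ succeeds.
   Context: A state on a finite-dimensional Hilbert space is a positive semidefinite operator of trace one. An $n$-partite state $\varrho$ is (fully) separable if it is a finite convex combination of product states $\varrho^{(1)}\otimes\cdots\otimes\varrho^{(n)}$; otherwise it is entangled. An entanglement witness on a tensor product space is a Hermitian operator $W$ such that $\operatorname{tr}(W\varrho_{\mathrm{sep}})\ge 0$ for all separable states and $\operatorname{tr}(W\varrho_{\mathrm{ent}})<0$ for at least one entangled state. Linear detection of $\varrho$ with $W$ means $\operatorname{tr}(W\varrho)<0$. Nonlinear detection of $\varrho$ with an operator $\mathcal{W}$ on $k$ copies means $\operatorname{tr}(\mathcal{W}\varrho^{\otimes k})<0$ while $\operatorname{tr}(\mathcal{W}\varrho_{\mathrm{sep}}^{\otimes k})\ge 0$ for all separable $n$-partite states $\varrho_{\mathrm{sep}}$. Convention for evaluating traces over copies: the total space consists of subsystems $(i,j)$, each a copy of $\mathbb{C}^d$, with party index $1\le i\le n$ and copy index $1\le j\le k$. The $j$-th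 tensor factor of $\varrho^{\otimes k}$ acts on $(1,j),\dots,(n,j)$. The operator $W$ acts on $(1,1),\dots,(1,k)$, and $P$ acts on all $(i,j)$ with $2\le i\le n$, $1\le j\le k$. In $\operatorname{tr}(W\varrho)$, $W$ is instead regarded as an operator on the $n=k$ parties of $\varrho$. *)

theory Defs
  imports Complex_Main "HOL-Library.FuncSet"
begin

text \<open>
  Operators on the finite-dimensional Hilbert space with orthonormal basis \<open>B\<close> are given by
  their matrix \<open>A x y\<close> (row \<open>x\<close>, column \<open>y\<close>); entries outside \<open>B \<times> B\<close> are irrelevant.
  The computational basis of the tensor product of one copy of \<open>\<complex>\<^sup>d\<close> per subsystem
  \<open>s \<in> S\<close> consists of the labellings of \<open>S\<close> by elements of \<open>{..<d}\<close>.
  Types cannot be existentially quantified, so \<open>d\<close>, the number of parties and the number of copies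
  enter through these carrier sets.
\<close>

type_synonym 'b oper = "'b \<Rightarrow> 'b \<Rightarrow> complex"

definition basis :: "nat \<Rightarrow> 's set \<Rightarrow> ('s \<Rightarrow> nat) set" where
  "basis d S = (\<Pi>\<^sub>E s\<in>S. {..<d})"

definition op_mult :: "'b set \<Rightarrow> 'b oper \<Rightarrow> 'b oper \<Rightarrow> 'b oper" where
  "op_mult B A C = (\<lambda>x y. \<Sum>z\<in>B. A x z * C z y)"

definition op_trace :: "'b set \<Rightarrow> 'b oper \<Rightarrow> complex" where
  "op_trace B A = (\<Sum>x\<in>B. A x x)"

definition hermitian :: "'b set \<Rightarrow> 'b oper \<Rightarrow> bool" where
  "hermitian B A \<longleftrightarrow> (\<forall>x\<in>B. \<forall>y\<in>B. A x y = cnj (A y x))"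

definition pos_semidef :: "'b set \<Rightarrow> 'b oper \<Rightarrow> bool" where
  "pos_semidef B A \<longleftrightarrow> hermitian B A \<and>
     (\<forall>v :: 'b \<Rightarrow> complex. 0 \<le> Re (\<Sum>x\<in>B. \<Sum>y\<in>B. cnj (v x) * A x y * v y))"

definition state :: "'b set \<Rightarrow> 'b oper \<Rightarrow> bool" where
  "state B \<rho> \<longleftrightarrow> pos_semidef B \<rho> \<and> op_trace B \<rho> = 1"

definition product_op :: "'s set \<Rightarrow> ('s \<Rightarrow> nat oper) \<Rightarrow> ('s \<Rightarrow> nat) oper" where
  "product_op S \<sigma> = (\<lambda>x y. \<Prod>s\<in>S. \<sigma> s (x s) (y s))"

definition separable :: "nat \<Rightarrow> 's set \<Rightarrow> ('s \<Rightarrow> nat) oper \<Rightarrow> bool" where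
  "separable d S \<rho> \<longleftrightarrow> state (basis d S) \<rho> \<and>
     (\<exists>(m :: nat) (p :: nat \<Rightarrow> real) (\<sigma> :: nat \<Rightarrow> 's \<Rightarrow> nat oper).
        (\<forall>a<m. 0 \<le> p a) \<and> (\<Sum>a<m. p a) = 1 \<and>
        (\<forall>a<m. \<forall>s\<in>S. state {..<d} (\<sigma> a s)) \<and>
        (\<forall>x\<in>basis d S. \<forall>y\<in>basis d S.
           \<rho> x y = (\<Sum>a<m. complex_of_real (p a) * product_op S (\<sigma> a) x y)))"

definition entangled :: "nat \<Rightarrow> 's set \<Rightarrow> ('s \<Rightarrow> nat) oper \<Rightarrow> bool" where
  "entangled d S \<rho> \<longleftrightarrow> state (basis d S) \<rho> \<and> \<not> separable d S \<rho>"

text \<open>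
  \<open>Re\<close> below only turns the value into a real number: the trace of a product of two Hermitian
  operators is real.
\<close>

definition expectation :: "'b set \<Rightarrow> 'b oper \<Rightarrow> 'b oper \<Rightarrow> real" where
  "expectation B W \<rho> = Re (op_trace B (op_mult B W \<rho>))"

definition entanglement_witness :: "nat \<Rightarrow> 's set \<Rightarrow> ('s \<Rightarrow> nat) oper \<Rightarrow> bool" where
  "entanglement_witness d S W \<longleftrightarrow> hermitian (basis d S) W \<and>
     (\<forall>\<rho>. separable d S \<rho> \<longrightarrow> 0 \<le> expectation (basis d S) W \<rho>) \<and>
     (\<exists>\<rho>. entangled d S \<rho> \<and> expectation (basis d S) W \<rho> < 0)"

text \<open>
  Subsystem \<open>(i, j)\<close> is party \<open>i\<close> of copy \<open>j\<close>. In \<open>copies n k \<rho>\<close>, the \<open>k\<close>-fold tensor power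
  of \<open>\<rho>\<close>, the \<open>j\<close>-th factor acts on \<open>(1, j), \<dots>, (n, j)\<close>.
\<close>

definition copies ::
  "nat \<Rightarrow> nat \<Rightarrow> (nat \<Rightarrow> nat) oper \<Rightarrow> (nat \<times> nat \<Rightarrow> nat) oper" where
  "copies n k \<rho> = (\<lambda>x y. \<Prod>j\<in>{1..k}. \<rho> (\<lambda>i\<in>{1..n}. x (i, j)) (\<lambda>i\<in>{1..n}. y (i, j)))"

text \<open>
  The tensor product of \<open>W\<close> on \<open>(1, 1), \<dots>, (1, k)\<close>, whose \<open>j\<close>-th factor is placed on
  \<open>(1, j)\<close>, with \<open>P\<close> on the remaining subsystems \<open>{2..n} \<times> {1..k}\<close>.
\<close>

definition tensor_first_rest ::
  "nat \<Rightarrow> nat \<Rightarrow> (nat \<Rightarrow> nat) oper \<Rightarrow> (nat \<times> nat \<Rightarrow> nat) oper \<Rightarrow> (nat \<times> nat \<Rightarrow> nat) oper" where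
  "tensor_first_rest n k W P = (\<lambda>x y.
     W (\<lambda>j\<in>{1..k}. x (1, j)) (\<lambda>j\<in>{1..k}. y (1, j)) *
     P (restrict x ({2..n} \<times> {1..k})) (restrict y ({2..n} \<times> {1..k})))"

definition nonlinearly_detects ::
  "nat \<Rightarrow> nat \<Rightarrow> nat \<Rightarrow> (nat \<times> nat \<Rightarrow> nat) oper \<Rightarrow> (nat \<Rightarrow> nat) oper \<Rightarrow> bool" where
  "nonlinearly_detects d n k \<W> \<rho> \<longleftrightarrow>
     expectation (basis d ({1..n} \<times> {1..k})) \<W> (copies n k \<rho>) < 0 \<and>
     (\<forall>\<tau>. separable d {1..n} \<tau> \<longrightarrow>
        0 \<le> expectation (basis d ({1..n} \<times> {1..k})) \<W> (copies n k \<tau>))"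

end

theory Submission
  imports Defs
begin

text \<open>
  Take \<open>d = n = k = 2\<close>, the swap operator as \<open>W\<close>, the maximally entangled state
  \<open>(|00\<rangle> + |11\<rangle>)/\<surd>2\<close> as \<open>\<rho>\<close> and the unnormalised projector onto the singlet
  \<open>|01\<rangle> - |10\<rangle>\<close> as \<open>P\<close>. The swap fixes \<open>\<rho>\<close>, so \<open>tr (W \<rho>) = 1\<close>. On two copies, however,
  \<open>P\<close> on the second parties steers the first parties into the singlet, on which the swap has
  eigenvalue \<open>-1\<close>. On separable states the two-copy trace is a convex combination of products
  \<open>tr (W (\<alpha> \<otimes> \<beta>)) tr (P (\<gamma> \<otimes> \<delta>))\<close>; the first factor is \<open>tr (\<alpha> \<beta>)\<close>, the second is
  \<open>tr (\<gamma> adj(\<delta>))\<close>, and both are nonnegative.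
\<close>

\<comment> \<open>The labels \<open>1\<close> and \<open>{1..2}\<close> have to survive simplification.\<close>
declare One_nat_def [simp del]

section \<open>Traces as nested sums over labels\<close>

lemma basis_empty: "basis d {} = {\<lambda>_. undefined}"
  by (simp add: basis_def)

lemma sum_basis_insert:
  assumes "s \<notin> S"
  shows "(\<Sum>x\<in>basis d (insert s S). f x) = (\<Sum>c<d. \<Sum>x\<in>basis d S. f (x(s := c)))"
proof -
  have "(\<Sum>x\<in>basis d (insert s S). f x) = (\<Sum>(c, x)\<in>{..<d} \<times> basis d S. f (x(s := c)))"
    unfolding basis_def PiE_insert_eq
    using inj_combinator[OF assms, of "\<lambda>_. {..<d}"]
    by (subst sum.reindex) (simp_all add: case_prod_unfold)
  then show ?thesis by (simp add: sum.cartesian_product)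
qed

lemma lessThan_two: "{..<2::nat} = {0, 1}"
  by auto

lemma parties_two: "{1..2::nat} = {1, 2}" "{2..2::nat} = {2}"
  by auto

lemma grid_two: "{1..2::nat} \<times> {1..2::nat} = {(1, 1), (1, 2), (2, 1), (2, 2)}"
  "{2..2::nat} \<times> {1..2::nat} = {(2, 1), (2, 2)}"
  unfolding parties_two by auto

text \<open>Serves both for the two parties of one copy and for the two copies of one party, since
  both are indexed by \<open>{1..2}\<close>.\<close>

definition ket :: "nat \<Rightarrow> nat \<Rightarrow> nat \<Rightarrow> nat" where
  "ket a b = (\<lambda>i\<in>{1..2}. if i = 1 then a else b)"

lemma ket_apply [simp]: "ket a b 1 = a" "ket a b 2 = b"
  by (simp_all add: ket_def)

lemma restrict_eq_ket: "restrict f {1..2} = ket (f 1) (f 2)"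
  unfolding ket_def parties_two by (auto simp: restrict_def fun_eq_iff)

lemma ket_in_basis: "a < d \<Longrightarrow> b < d \<Longrightarrow> ket a b \<in> basis d {1..2}"
  by (auto simp: ket_def basis_def)

lemma sum_basis_pair: "(\<Sum>x\<in>basis d {1..2}. f x) = (\<Sum>a<d. \<Sum>b<d. f (ket a b))"
proof -
  have *: "(\<lambda>_. undefined)(2 := b, 1 := a) = ket a b" for a b
    unfolding ket_def parties_two by (auto simp: restrict_def fun_eq_iff)
  show ?thesis
    by (simp add: parties_two sum_basis_insert basis_empty *)
qed

section \<open>Positive matrices of size two\<close>

lemma pos_semidef_rank_one: "pos_semidef B (\<lambda>x y. u x * cnj (u y))"
  unfolding pos_semidef_def hermitian_def
proof (intro conjI ballI allI)
  fix v
  have "(\<Sum>x\<in>B. \<Sum>y\<in>B. cnj (v x) * (u x * cnj (u y)) * v y)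
      = (\<Sum>x\<in>B. cnj (v x) * u x) * cnj (\<Sum>x\<in>B. cnj (v x) * u x)"
    by (simp add: sum_product mult_ac)
  then show "0 \<le> Re (\<Sum>x\<in>B. \<Sum>y\<in>B. cnj (v x) * (u x * cnj (u y)) * v y)"
    unfolding complex_norm_square[symmetric] by simp
qed simp

lemma state_two_entries:
  fixes A :: "nat oper"
  assumes "state {..<2} A"
  obtains p q z where "A 0 0 = complex_of_real p" "A 1 1 = complex_of_real q"
    "A 0 1 = z" "A 1 0 = cnj z" "0 \<le> p" "0 \<le> q" "(cmod z)\<^sup>2 \<le> p * q"
proof -
  define p q z where "p = Re (A 0 0)" and "q = Re (A 1 1)" and "z = A 0 1"
  have herm: "A x y = cnj (A y x)" if "x < 2" "y < 2" for x y
    using assms that unfolding state_def pos_semidef_def hermitian_def by blast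
  have A: "A 0 0 = complex_of_real p" "A 1 1 = complex_of_real q" "A 1 0 = cnj z"
    using herm[of 0 0] herm[of 1 1] herm[of 1 0] by (auto simp: p_def q_def z_def complex_eq_iff)
  have pos: "0 \<le> p * (cmod a)\<^sup>2 + q * (cmod b)\<^sup>2 + 2 * Re (cnj a * z * b)" for a b
  proof -
    have "0 \<le> Re (\<Sum>x\<in>{..<2}. \<Sum>y\<in>{..<2}. cnj (if x = 0 then a else b) * A x y * (if y = 0 then a else b))"
      using assms unfolding state_def pos_semidef_def
      by (elim conjE allE[of _ "\<lambda>x. if x = 0 then a else b"])
    then show ?thesis
      using A z_def by (simp add: lessThan_two cmod_power2) (simp add: algebra_simps power2_eq_square)
  qed
  have p0: "0 \<le> p" and q0: "0 \<le> q"
    using pos[of 1 0] pos[of 0 1] by simp_all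
  have pq: "p + q = 1"
    using assms A by (auto simp: state_def op_trace_def lessThan_two complex_eq_iff)
  \<comment> \<open>The test vectors here and below are the columns of the adjugate of
    \<open>A\<close>. Since \<open>A\<close> maps each to the determinant times a basis vector, the
    form yields the determinant times a diagonal entry; adding the two uses the unit trace and
    avoids a case split on \<open>p = 0\<close>.\<close>
  have "0 \<le> p * (p * q - (cmod z)\<^sup>2)"
    using pos[of "- z" "of_real p"] by (simp add: cmod_power2) (simp add: algebra_simps power2_eq_square)
  moreover have "0 \<le> q * (p * q - (cmod z)\<^sup>2)"
    using pos[of "of_real q" "- cnj z"] by (simp add: cmod_power2) (simp add: algebra_simps power2_eq_square)
  ultimately have "0 \<le> (p + q) * (p * q - (cmod z)\<^sup>2)"
    by (simp add: distrib_right)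
  then have "(cmod z)\<^sup>2 \<le> p * q"
    using pq by simp
  with that A p0 q0 z_def show thesis by simp
qed

text \<open>This is the trace of a product of two positive matrices, with \<open>z\<close> the upper
  right entry of the first and \<open>w\<close> the lower left entry of the second. The determinant
  bounds combine with the inequality of arithmetic and geometric means for \<open>p * p'\<close> and
  \<open>q * q'\<close>.\<close>

lemma trace_prod_nonneg:
  fixes z w :: complex
  assumes "0 \<le> p" "0 \<le> q" "(cmod z)\<^sup>2 \<le> p * q" "0 \<le> p'" "0 \<le> q'" "(cmod w)\<^sup>2 \<le> p' * q'"
  shows "0 \<le> p * p' + q * q' + 2 * Re (z * w)"
proof -
  have "(cmod (z * w))\<^sup>2 \<le> (p * q) * (p' * q')"
    unfolding norm_mult power_mult_distrib using assms by (intro mult_mono) auto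
  also have "4 * \<dots> \<le> (p * p' + q * q')\<^sup>2"
    using zero_le_power2[of "p * p' - q * q'"] by (simp add: algebra_simps power2_eq_square)
  finally have "(2 * cmod (z * w))\<^sup>2 \<le> (p * p' + q * q')\<^sup>2"
    by (simp add: power_mult_distrib)
  then have "2 * cmod (z * w) \<le> p * p' + q * q'"
    by (rule power2_le_imp_le) (use assms in simp)
  then show ?thesis
    using abs_Re_le_cmod[of "z * w"] by linarith
qed

text \<open>Realness is part of the conclusion because such traces of the two parties get multiplied
  later, and nonnegative real parts alone would not survive a product.\<close>

lemma trace_prod_state:
  fixes \<alpha> \<beta> :: "nat oper"
  assumes "state {..<2} \<alpha>" "state {..<2} \<beta>"
  shows "\<exists>r\<ge>0. \<alpha> 0 0 * \<beta> 0 0 + \<alpha> 1 1 * \<beta> 1 1 + \<alpha> 0 1 * \<beta> 1 0 + \<alpha> 1 0 * \<beta> 0 1 = complex_of_real r"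
proof -
  from assms(1) obtain p q z where a: "\<alpha> 0 0 = complex_of_real p" "\<alpha> 1 1 = complex_of_real q"
    "\<alpha> 0 1 = z" "\<alpha> 1 0 = cnj z" "0 \<le> p" "0 \<le> q" "(cmod z)\<^sup>2 \<le> p * q"
    by (rule state_two_entries)
  from assms(2) obtain p' q' w where b: "\<beta> 0 0 = complex_of_real p'" "\<beta> 1 1 = complex_of_real q'"
    "\<beta> 0 1 = w" "\<beta> 1 0 = cnj w" "0 \<le> p'" "0 \<le> q'" "(cmod w)\<^sup>2 \<le> p' * q'"
    by (rule state_two_entries)
  show ?thesis
    using trace_prod_nonneg[of p q z p' q' "cnj w"] a b
    by (intro exI[of _ "p * p' + q * q' + 2 * Re (z * cnj w)"]) (simp add: complex_eq_iff)
qed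

text \<open>The adjugate of \<beta> exchanges the diagonal entries and negates the others, hence
  \<open>q'\<close>, \<open>p'\<close> and \<open>- cnj w\<close> in place of \<open>p'\<close>,
  \<open>q'\<close> and \<open>cnj w\<close>.\<close>

lemma trace_adjugate_state:
  fixes \<alpha> \<beta> :: "nat oper"
  assumes "state {..<2} \<alpha>" "state {..<2} \<beta>"
  shows "\<exists>r\<ge>0. \<alpha> 0 0 * \<beta> 1 1 + \<alpha> 1 1 * \<beta> 0 0 - \<alpha> 0 1 * \<beta> 1 0 - \<alpha> 1 0 * \<beta> 0 1 = complex_of_real r"
proof -
  from assms(1) obtain p q z where a: "\<alpha> 0 0 = complex_of_real p" "\<alpha> 1 1 = complex_of_real q"
    "\<alpha> 0 1 = z" "\<alpha> 1 0 = cnj z" "0 \<le> p" "0 \<le> q" "(cmod z)\<^sup>2 \<le> p * q"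
    by (rule state_two_entries)
  from assms(2) obtain p' q' w where b: "\<beta> 0 0 = complex_of_real p'" "\<beta> 1 1 = complex_of_real q'"
    "\<beta> 0 1 = w" "\<beta> 1 0 = cnj w" "0 \<le> p'" "0 \<le> q'" "(cmod w)\<^sup>2 \<le> p' * q'"
    by (rule state_two_entries)
  show ?thesis
    using trace_prod_nonneg[of p q z q' p' "- cnj w"] a b
    by (intro exI[of _ "p * q' + q * p' - 2 * Re (z * cnj w)"]) (simp add: complex_eq_iff mult.commute)
qed

section \<open>The operators and the two-copy trace\<close>

definition swap_op :: "(nat \<Rightarrow> nat) oper" where
  "swap_op x y = (if x 1 = y 2 \<and> x 2 = y 1 then 1 else 0)"

definition bell_vec :: "(nat \<Rightarrow> nat) \<Rightarrow> complex" where
  "bell_vec x = (if x 1 = x 2 then complex_of_real (sqrt (1 / 2)) else 0)"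

definition bell_op :: "(nat \<Rightarrow> nat) oper" where
  "bell_op x y = bell_vec x * cnj (bell_vec y)"

text \<open>On labels in \<open>{0, 1}\<close> this is the vector \<open>|01\<rangle> - |10\<rangle>\<close> of the subsystems \<open>s\<close> and \<open>t\<close>.\<close>

definition singlet_vec :: "('s \<Rightarrow> nat) \<Rightarrow> 's \<Rightarrow> 's \<Rightarrow> complex" where
  "singlet_vec x s t = of_nat (x t) - of_nat (x s)"

text \<open>The subsystems stay free because the operator is used twice: on the second parties of
  both copies as \<open>P\<close>, and on parties 1 and 2 for a state detected by the swap.\<close>

definition singlet_op :: "'s \<Rightarrow> 's \<Rightarrow> ('s \<Rightarrow> nat) oper" where
  "singlet_op s t x y = singlet_vec x s t * cnj (singlet_vec y s t)"

lemma expectation_swap: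
  "expectation (basis 2 {1..2}) swap_op \<tau> =
     Re (\<tau> (ket 0 0) (ket 0 0) + \<tau> (ket 1 1) (ket 1 1) + \<tau> (ket 0 1) (ket 1 0) + \<tau> (ket 1 0) (ket 0 1))"
  by (simp add: expectation_def op_trace_def op_mult_def sum_basis_pair lessThan_two swap_op_def)

lemma pos_semidef_singlet_op: "pos_semidef B (singlet_op s t)"
  unfolding singlet_op_def by (rule pos_semidef_rank_one)

lemma state_bell: "state (basis 2 {1..2}) bell_op"
  unfolding state_def
proof
  show "pos_semidef (basis 2 {1..2}) bell_op"
    unfolding bell_op_def by (rule pos_semidef_rank_one)
  show "op_trace (basis 2 {1..2}) bell_op = 1"
    by (simp add: op_trace_def sum_basis_pair lessThan_two bell_op_def bell_vec_def flip: of_real_mult)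
qed

lemma sum_lessThan_two: "sum f {..<2::nat} = f 0 + f 1"
  by (simp add: lessThan_two add.commute)

text \<open>The two-copy trace as a polynomial in the entries of \<tau>: the swap crosses the labels
  \<open>a\<close>, \<open>b\<close> of the first parties, and the four signed terms come from the
  projector onto the singlet.\<close>

definition swap_singlet_form :: "(nat \<Rightarrow> nat) oper \<Rightarrow> complex" where
  "swap_singlet_form \<tau> = (\<Sum>a<2. \<Sum>b<2.
     \<tau> (ket a 0) (ket b 0) * \<tau> (ket b 1) (ket a 1)
   + \<tau> (ket a 1) (ket b 1) * \<tau> (ket b 0) (ket a 0)
   - \<tau> (ket a 0) (ket b 1) * \<tau> (ket b 1) (ket a 0)
   - \<tau> (ket a 1) (ket b 0) * \<tau> (ket b 0) (ket a 1))"

definition quad :: "nat \<Rightarrow> nat \<Rightarrow> nat \<Rightarrow> nat \<Rightarrow> nat \<times> nat \<Rightarrow> nat" where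
  "quad a b c e = (\<lambda>(i, j)\<in>{1..2} \<times> {1..2}. ket (ket a b j) (ket c e j) i)"

lemma quad_apply [simp]:
  "quad a b c e (1, 1) = a" "quad a b c e (1, 2) = b" "quad a b c e (2, 1) = c" "quad a b c e (2, 2) = e"
  by (simp_all add: quad_def)

lemma sum_basis_grid:
  "(\<Sum>x\<in>basis d ({1..2} \<times> {1..2}). f x) = (\<Sum>a<d. \<Sum>b<d. \<Sum>c<d. \<Sum>e<d. f (quad a b c e))"
proof -
  have *: "(\<lambda>_. undefined)((2, 2) := e, (2, 1) := c, (1, 2) := b, (1, 1) := a) = quad a b c e"
    for a b c e
    unfolding quad_def grid_two by (auto simp: restrict_def fun_eq_iff)
  show ?thesis
    by (simp add: grid_two sum_basis_insert basis_empty *)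
qed

lemma copies_quad:
  "copies 2 2 \<tau> (quad a b c e) (quad a' b' c' e') = \<tau> (ket a c) (ket a' c') * \<tau> (ket b e) (ket b' e')"
  by (simp add: copies_def restrict_eq_ket) (simp add: parties_two)

lemma tensor_quad:
  "tensor_first_rest 2 2 swap_op (singlet_op (2, 1) (2, 2)) (quad a b c e) (quad a' b' c' e') =
     (if a = b' \<and> b = a' then (of_nat e - of_nat c) * (of_nat e' - of_nat c') else 0)"
  by (simp add: tensor_first_rest_def restrict_eq_ket swap_op_def singlet_op_def singlet_vec_def)

lemma expectation_swap_singlet_copies:
  "expectation (basis 2 ({1..2} \<times> {1..2}))
     (tensor_first_rest 2 2 swap_op (singlet_op (2, 1) (2, 2))) (copies 2 2 \<tau>)
   = Re (swap_singlet_form \<tau>)"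
proof -
  show ?thesis
    unfolding expectation_def op_trace_def op_mult_def sum_basis_grid copies_quad tensor_quad
      swap_singlet_form_def sum_lessThan_two
    \<comment> \<open>Both sides agree already as complex polynomials, so \<open>Re\<close> is kept
      from being distributed over them.\<close>
    by (simp del: plus_complex.sel minus_complex.sel times_complex.sel)
      (simp del: plus_complex.sel minus_complex.sel times_complex.sel add: algebra_simps)
qed

text \<open>The positive terms vanish. The negative ones contribute -1/4 each, at
  \<open>a = 0, b = 1\<close> and at \<open>a = 1, b = 0\<close>, so the value is -1/2.\<close>

lemma swap_singlet_form_bell: "Re (swap_singlet_form bell_op) < 0"
  by (simp add: swap_singlet_form_def lessThan_two bell_op_def bell_vec_def flip: of_real_mult)

section \<open>Separable states\<close>

lemma separable_expectations:
  assumes "separable 2 {1..2} \<tau>"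
  shows "0 \<le> expectation (basis 2 {1..2}) swap_op \<tau>" and "0 \<le> Re (swap_singlet_form \<tau>)"
proof -
  obtain m :: nat and p \<sigma> where p: "\<forall>a<m. 0 \<le> p a"
    and \<sigma>: "\<forall>a<m. \<forall>s\<in>{1..2}. state {..<2} (\<sigma> a s)"
    and dec: "\<forall>x\<in>basis 2 {1..2}. \<forall>y\<in>basis 2 {1..2}.
      \<tau> x y = (\<Sum>a<m. complex_of_real (p a) * product_op {1..2} (\<sigma> a) x y)"
    using assms unfolding separable_def by (elim conjE exE) (rule that, assumption+)
  have lt: "0 < (2::nat)" "1 < (2::nat)"
    by simp_all
  have \<tau>: "\<tau> (ket a b) (ket c e) = (\<Sum>l<m. complex_of_real (p l) * (\<sigma> l 1 a c * \<sigma> l 2 b e))"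
    if "a < 2" "b < 2" "c < 2" "e < 2" for a b c e
    using that by (simp add: dec ket_in_basis) (simp add: product_op_def parties_two)
  \<comment> \<open>Each copy of \<tau> picks its own component, \<open>l\<close> or
    \<open>l'\<close>. For such a pair the trace factors by party: \<open>S\<close> is the swap on
    the first parties, \<open>R\<close> the singlet on the second.\<close>
  define S where "S l l' = \<sigma> l 1 0 0 * \<sigma> l' 1 0 0 + \<sigma> l 1 1 1 * \<sigma> l' 1 1 1
    + \<sigma> l 1 0 1 * \<sigma> l' 1 1 0 + \<sigma> l 1 1 0 * \<sigma> l' 1 0 1" for l l'
  define R where "R l l' = \<sigma> l 2 0 0 * \<sigma> l' 2 1 1 + \<sigma> l 2 1 1 * \<sigma> l' 2 0 0
    - \<sigma> l 2 0 1 * \<sigma> l' 2 1 0 - \<sigma> l 2 1 0 * \<sigma> l' 2 0 1" for l l'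
  have "swap_singlet_form \<tau> = (\<Sum>l<m. \<Sum>l'<m. complex_of_real (p l * p l') * (S l l' * R l l'))"
    unfolding swap_singlet_form_def sum_lessThan_two
    by (simp only: \<tau> lt sum_product sum.distrib[symmetric] sum_subtractf[symmetric],
        intro sum.cong refl, simp only: S_def R_def of_real_mult, algebra)
  also have "0 \<le> Re \<dots>"
    unfolding Re_sum
  proof (intro sum_nonneg)
    fix l l' assume "l \<in> {..<m}" "l' \<in> {..<m}"
    then obtain s r where "S l l' = complex_of_real s" "R l l' = complex_of_real r"
      "0 \<le> s" "0 \<le> r" "0 \<le> p l" "0 \<le> p l'"
      using trace_prod_state[OF \<sigma>[rule_format] \<sigma>[rule_format], of l 1 l' 1]
        trace_adjugate_state[OF \<sigma>[rule_format] \<sigma>[rule_format], of l 2 l' 2]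
        p
      by (auto simp: S_def R_def)
    then show "0 \<le> Re (complex_of_real (p l * p l') * (S l l' * R l l'))"
      by simp
  qed
  finally show "0 \<le> Re (swap_singlet_form \<tau>)" .
  \<comment> \<open>With one copy, the swap pairs the two parties of the same component instead of
    one party in two components.\<close>
  have "\<tau> (ket 0 0) (ket 0 0) + \<tau> (ket 1 1) (ket 1 1) + \<tau> (ket 0 1) (ket 1 0) + \<tau> (ket 1 0) (ket 0 1)
    = (\<Sum>l<m. complex_of_real (p l) * (\<sigma> l 1 0 0 * \<sigma> l 2 0 0 + \<sigma> l 1 1 1 * \<sigma> l 2 1 1
      + \<sigma> l 1 0 1 * \<sigma> l 2 1 0 + \<sigma> l 1 1 0 * \<sigma> l 2 0 1))"
    by (simp add: \<tau> distrib_left sum.distrib)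
  also have "0 \<le> Re \<dots>"
    unfolding Re_sum
  proof (intro sum_nonneg)
    fix l assume "l \<in> {..<m}"
    then obtain r where "\<sigma> l 1 0 0 * \<sigma> l 2 0 0 + \<sigma> l 1 1 1 * \<sigma> l 2 1 1
        + \<sigma> l 1 0 1 * \<sigma> l 2 1 0 + \<sigma> l 1 1 0 * \<sigma> l 2 0 1 = complex_of_real r"
      and "0 \<le> r" and "0 \<le> p l"
      using trace_prod_state[OF \<sigma>[rule_format] \<sigma>[rule_format], of l 1 l 2] p by auto
    then show "0 \<le> Re (complex_of_real (p l) * (\<sigma> l 1 0 0 * \<sigma> l 2 0 0 + \<sigma> l 1 1 1 * \<sigma> l 2 1 1
      + \<sigma> l 1 0 1 * \<sigma> l 2 1 0 + \<sigma> l 1 1 0 * \<sigma> l 2 0 1))"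
      by (simp only: flip: of_real_mult) simp
  qed
  finally show "0 \<le> expectation (basis 2 {1..2}) swap_op \<tau>"
    by (simp only: expectation_swap)
qed

section \<open>The swap as a witness\<close>

definition singlet_state :: "(nat \<Rightarrow> nat) oper" where
  "singlet_state x y = singlet_op 1 2 x y / 2"

lemma state_singlet: "state (basis 2 {1..2}) singlet_state"
  unfolding state_def
proof
  have *: "singlet_state = (\<lambda>x y. (singlet_vec x 1 2 / sqrt 2) * cnj (singlet_vec y 1 2 / sqrt 2))"
    by (simp add: singlet_state_def singlet_op_def fun_eq_iff flip: of_real_mult)
  show "pos_semidef (basis 2 {1..2}) singlet_state"
    unfolding * by (rule pos_semidef_rank_one)
  show "op_trace (basis 2 {1..2}) singlet_state = 1"
    by (simp add: op_trace_def sum_basis_pair lessThan_two singlet_state_def singlet_op_def singlet_vec_def)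
qed

text \<open>The singlet is antisymmetric, so the swap acts on it as -1. The Bell state has
  expectation 1 and cannot serve here.\<close>

lemma expectation_swap_singlet: "expectation (basis 2 {1..2}) swap_op singlet_state = - 1"
  by (simp add: expectation_swap singlet_state_def singlet_op_def singlet_vec_def)

lemma entanglement_witness_swap: "entanglement_witness 2 {1..2} swap_op"
  unfolding entanglement_witness_def
proof (intro conjI)
  show "hermitian (basis 2 {1..2}) swap_op"
    by (auto simp: hermitian_def swap_op_def)
  \<comment> \<open>A separable state would have nonnegative expectation, so the value -1 proves
    entanglement.\<close>
  have "entangled 2 {1..2} singlet_state"
    using state_singlet separable_expectations(1)[of singlet_state] expectation_swap_singlet
    by (auto simp: entangled_def)
  then show "\<exists>\<rho>. entangled 2 {1..2} \<rho> \<and> expectation (basis 2 {1..2}) swap_op \<rho> < 0"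
    using expectation_swap_singlet by (intro exI[of _ singlet_state]) simp
qed (use separable_expectations(1) in blast)

theorem mainTheorem2:
  shows "\<exists>(d :: nat) (n :: nat) (k :: nat) (\<rho> :: (nat \<Rightarrow> nat) oper) (W :: (nat \<Rightarrow> nat) oper).
    d \<ge> 2 \<and> n = k \<and> k \<ge> 2 \<and>
    state (basis d {1..n}) \<rho> \<and>
    entanglement_witness d {1..k} W \<and>
    0 \<le> expectation (basis d {1..n}) W \<rho> \<and>
    (\<exists>P :: (nat \<times> nat \<Rightarrow> nat) oper.
       pos_semidef (basis d ({2..n} \<times> {1..k})) P \<and>
       nonlinearly_detects d n k (tensor_first_rest n k W P) \<rho>)"
proof (rule exI[of _ 2], rule exI[of _ 2], rule exI[of _ 2], rule exI[of _ bell_op], rule exI[of _ swap_op],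
    intro exI[of _ "singlet_op (2, 1) (2, 2)"] conjI)
  show "0 \<le> expectation (basis 2 {1..2}) swap_op bell_op"
    by (simp add: expectation_swap bell_op_def bell_vec_def)
  show "nonlinearly_detects 2 2 2 (tensor_first_rest 2 2 swap_op (singlet_op (2, 1) (2, 2))) bell_op"
    unfolding nonlinearly_detects_def expectation_swap_singlet_copies
    using swap_singlet_form_bell separable_expectations(2) by blast
qed (use state_bell entanglement_witness_swap pos_semidef_singlet_op in auto)

end
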